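(* Let $\mathcal{C}$ be the class of LEF groups, let $\Gamma$ be a LEF group, let $\Delta$ be a group, and suppose $\Gamma\curvearrowright_{\beta}\Delta$ is a $\mathcal{C}$-LEF action by automorphisms. Then $\Delta\rtimes_{\beta}\Gamma$ is a LEF group.
   Context: A partial homomorphism from a subset $A$ of a group to a group $K$ is a function $\phi:A\to K$ with $\phi(gh)=\phi(g)\phi(h)$ whenever $g,h,gh\in A$. A group $\Gamma$ is LEF (locally embeddable into finite groups) if for every finite $A\subseteq\Gamma$ there is a finite group $Q$ and an injective partial homomorphism $A\to Q$. For a class $\mathcal{C}$ of groups, an action $\Gamma\curvearrowright_\beta\Delta$ of a group $\Gamma$ by automorphisms on a group $\Delta$ is $\mathcal{C}$-LEF if for all finite subsets $F\subseteq\Gamma$ and $E\subseteq\Delta$ there are a finite group $Q$, a group $K\in\mathcal{C}$, an action $Q\curvearrowright_\gamma K$ by automorphisms, and partial homomorphisms $\rho:F\to Q$ and $\pi:E\to K$, with $\pi$ injective, such that for all $g\in F$ and $h\in E$, if $\beta(g)[h]\in E$ then $\pi(\beta(g)[h])=\gamma(\rho(g))[\pi(h)]$. *)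

theory Defs
  imports "HOL-Algebra.Algebra"
begin

definition partial_hom ::
    "('a, 'm) monoid_scheme \<Rightarrow> 'a set \<Rightarrow> ('b, 'n) monoid_scheme \<Rightarrow> ('a \<Rightarrow> 'b) set"
  where "partial_hom G A K =
    {\<phi>. \<phi> \<in> A \<rightarrow> carrier K \<and>
        (\<forall>g\<in>A. \<forall>h\<in>A. g \<otimes>\<^bsub>G\<^esub> h \<in> A \<longrightarrow> \<phi> (g \<otimes>\<^bsub>G\<^esub> h) = \<phi> g \<otimes>\<^bsub>K\<^esub> \<phi> h)}"

text \<open>
  A definition cannot quantify over types. Every finite group is isomorphic to one whose carrier
  is a set of natural numbers, so below ``there is a finite group \<open>Q\<close>'' is rendered as
  ``there is a finite group \<open>Q :: nat monoid\<close>''. The lemmas \<open>LEF_witness_any_type\<close> and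
  \<open>action_witness_any_type\<close> show that this is no restriction.
\<close>

definition LEF :: "('a, 'm) monoid_scheme \<Rightarrow> bool"
  where "LEF G \<longleftrightarrow> group G \<and>
    (\<forall>A. finite A \<and> A \<subseteq> carrier G \<longrightarrow>
      (\<exists>(Q :: nat monoid) \<phi>. group Q \<and> finite (carrier Q) \<and>
         \<phi> \<in> partial_hom G A Q \<and> inj_on \<phi> A))"

text \<open>
  Elements of \<^const>\<open>AutoGroup\<close> are extensional functions, i.e. \<open>\<beta> g\<close> is \<^const>\<open>undefined\<close> outside
  \<open>carrier D\<close>; this only normalises the values where they are irrelevant.
\<close>

definition action_by_automorphisms ::
    "('g, 'm) monoid_scheme \<Rightarrow> ('d, 'n) monoid_scheme \<Rightarrow> ('g \<Rightarrow> 'd \<Rightarrow> 'd) \<Rightarrow> bool"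
  where "action_by_automorphisms G D \<beta> \<longleftrightarrow>
    group G \<and> group D \<and> \<beta> \<in> hom G (AutoGroup D)"

text \<open>
  The class \<open>C\<close> is a set of groups over a type \<open>'k\<close>, so all the groups \<open>K\<close> witnessing the
  property, for the various \<open>F\<close> and \<open>E\<close>, live in one type. As there is only a set of pairs
  \<open>(F, E)\<close> and the classes in question are closed under isomorphism, this loses nothing as long
  as \<open>'k\<close> itself is arbitrary.
\<close>

definition class_LEF_action ::
    "'k monoid set \<Rightarrow> ('g, 'm) monoid_scheme \<Rightarrow> ('d, 'n) monoid_scheme \<Rightarrow>
      ('g \<Rightarrow> 'd \<Rightarrow> 'd) \<Rightarrow> bool"
  where "class_LEF_action C G D \<beta> \<longleftrightarrow>
    action_by_automorphisms G D \<beta> \<and>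
    (\<forall>F E. finite F \<and> F \<subseteq> carrier G \<and> finite E \<and> E \<subseteq> carrier D \<longrightarrow>
      (\<exists>(Q :: nat monoid) K \<gamma> \<rho> \<pi>.
         group Q \<and> finite (carrier Q) \<and> group K \<and> K \<in> C \<and>
         action_by_automorphisms Q K \<gamma> \<and>
         \<rho> \<in> partial_hom G F Q \<and> \<pi> \<in> partial_hom D E K \<and> inj_on \<pi> E \<and>
         (\<forall>g\<in>F. \<forall>h\<in>E. \<beta> g h \<in> E \<longrightarrow> \<pi> (\<beta> g h) = \<gamma> (\<rho> g) (\<pi> h))))"

definition semidirect_product ::
    "('d, 'n) monoid_scheme \<Rightarrow> ('g \<Rightarrow> 'd \<Rightarrow> 'd) \<Rightarrow> ('g, 'm) monoid_scheme \<Rightarrow> ('d \<times> 'g) monoid"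
  where "semidirect_product D \<beta> G =
    \<lparr>carrier = carrier D \<times> carrier G,
     monoid.mult = (\<lambda>(d, g) (d', g'). (d \<otimes>\<^bsub>D\<^esub> \<beta> g d', g \<otimes>\<^bsub>G\<^esub> g')),
     monoid.one = (\<one>\<^bsub>D\<^esub>, \<one>\<^bsub>G\<^esub>)\<rparr>"


lemma finite_group_iso_nat:
  assumes "group Q" "finite (carrier Q)"
  obtains Q' :: "nat monoid" and i j where
    "group Q'" "finite (carrier Q')" "i \<in> iso Q Q'" "j \<in> iso Q' Q"
    "\<And>x. x \<in> carrier Q \<Longrightarrow> j (i x) = x"
proof -
  interpret Q: group Q by fact
  obtain i :: "_ \<Rightarrow> nat" where i: "inj_on i (carrier Q)"
    using assms(2) finite_imp_inj_to_nat_seg by blast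
  define j where "j = inv_into (carrier Q) i"
  have j: "j (i x) = x" if "x \<in> carrier Q" for x
    using that i by (simp add: j_def)
  define Q' where "Q' = \<lparr>carrier = i ` carrier Q,
    monoid.mult = (\<lambda>a b. i (j a \<otimes>\<^bsub>Q\<^esub> j b)), monoid.one = i \<one>\<^bsub>Q\<^esub>\<rparr>"
  have iso: "i \<in> iso Q Q'"
    using i j by (auto simp: iso_def hom_def bij_betw_def Q'_def)
  have "group Q'"
  proof (rule groupI)
    fix x assume "x \<in> carrier Q'"
    then obtain a where a: "a \<in> carrier Q" "x = i a" by (auto simp: Q'_def)
    show "\<exists>y\<in>carrier Q'. y \<otimes>\<^bsub>Q'\<^esub> x = \<one>\<^bsub>Q'\<^esub>"
      using a j by (intro bexI[of _ "i (inv\<^bsub>Q\<^esub> a)"]) (auto simp: Q'_def)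
  qed (use j in \<open>auto simp: Q'_def Q.m_assoc\<close>)
  moreover have "finite (carrier Q')" using assms(2) by (simp add: Q'_def)
  moreover have "j \<in> iso Q' Q"
    using Q.iso_set_sym[OF iso] by (simp add: j_def)
  ultimately show ?thesis using that iso j by blast
qed

lemma partial_hom_compose:
  assumes "\<phi> \<in> partial_hom G A Q" "i \<in> hom Q Q'"
  shows "i \<circ> \<phi> \<in> partial_hom G A Q'"
  using assms by (auto simp: partial_hom_def hom_def Pi_iff)

lemma LEF_witness_any_type:
  fixes G :: "('a, 'm) monoid_scheme" and Q :: "('q, 'n) monoid_scheme"
  assumes "group Q" "finite (carrier Q)" "\<phi> \<in> partial_hom G A Q" "inj_on \<phi> A"
  shows "\<exists>(Q' :: nat monoid) \<phi>'. group Q' \<and> finite (carrier Q') \<and>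
    \<phi>' \<in> partial_hom G A Q' \<and> inj_on \<phi>' A"
proof -
  obtain Q' :: "nat monoid" and i j where Q': "group Q'" "finite (carrier Q')" "i \<in> iso Q Q'"
    using finite_group_iso_nat[OF assms(1,2)] by metis
  have "i \<circ> \<phi> \<in> partial_hom G A Q'"
    using assms(3) Q'(3) partial_hom_compose by (auto simp: iso_def)
  moreover have "inj_on (i \<circ> \<phi>) A"
  proof (rule comp_inj_on[OF assms(4)])
    show "inj_on i (\<phi> ` A)"
      using Q'(3) assms(3)
      by (auto simp: iso_def bij_betw_def partial_hom_def Pi_iff intro: inj_on_subset)
  qed
  ultimately show ?thesis using Q' by blast
qed

lemma action_witness_any_type:
  fixes Q :: "('q, 'n) monoid_scheme"
  assumes "group Q" "finite (carrier Q)" "action_by_automorphisms Q K \<gamma>"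
    "\<rho> \<in> partial_hom G F Q"
    "\<forall>g\<in>F. \<forall>h\<in>E. \<beta> g h \<in> E \<longrightarrow> \<pi> (\<beta> g h) = \<gamma> (\<rho> g) (\<pi> h)"
  shows "\<exists>(Q' :: nat monoid) \<gamma>' \<rho>'. group Q' \<and> finite (carrier Q') \<and>
    action_by_automorphisms Q' K \<gamma>' \<and> \<rho>' \<in> partial_hom G F Q' \<and>
    (\<forall>g\<in>F. \<forall>h\<in>E. \<beta> g h \<in> E \<longrightarrow> \<pi> (\<beta> g h) = \<gamma>' (\<rho>' g) (\<pi> h))"
proof -
  obtain Q' :: "nat monoid" and i j where Q': "group Q'" "finite (carrier Q')" "i \<in> iso Q Q'"
      "j \<in> iso Q' Q" "\<And>x. x \<in> carrier Q \<Longrightarrow> j (i x) = x"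
    using finite_group_iso_nat[OF assms(1,2)] by metis
  have "i \<circ> \<rho> \<in> partial_hom G F Q'"
    using assms(4) Q'(3) partial_hom_compose by (auto simp: iso_def)
  moreover have "action_by_automorphisms Q' K (\<gamma> \<circ> j)"
    using assms(3) Q'(1,4) Group.hom_compose
    by (fastforce simp: action_by_automorphisms_def iso_def)
  moreover have "\<rho> g \<in> carrier Q" if "g \<in> F" for g
    using that assms(4) by (auto simp: partial_hom_def)
  hence "\<forall>g\<in>F. \<forall>h\<in>E. \<beta> g h \<in> E \<longrightarrow> \<pi> (\<beta> g h) = (\<gamma> \<circ> j) ((i \<circ> \<rho>) g) (\<pi> h)"
    using assms(5) Q'(5) by simp
  ultimately show ?thesis using Q'(1,2) by blast
qed

end

theory Submission
  imports Defs
begin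

text \<open>
  Let a finite \<open>A \<subseteq> \<Delta> \<rtimes> \<Gamma>\<close> be given. Choose \<open>\<sigma>\<close> into a finite group \<open>P\<close>, injective on the
  \<open>\<Gamma>\<close>-parts of \<open>A\<close>, and \<open>Q\<close>, \<open>K\<close>, \<open>\<gamma>\<close>, \<open>\<rho>\<close>, \<open>\<pi>\<close> from the hypothesis on \<open>\<beta>\<close>. Finally choose \<open>\<psi>\<close> into
  a finite group \<open>L\<close>, injective on a finite \<open>Q\<close>-invariant subset of \<open>K\<close>. Sending \<open>d\<close> to the
  function \<open>x \<mapsto> \<psi> (\<gamma> x\<^sup>-\<^sup>1 (\<pi> d))\<close> in \<open>L\<^sup>Q\<close> is equivariant for the shift of \<open>Q\<close>, so that \<open>A\<close>
  embeds into \<open>(L\<^sup>Q \<rtimes> Q) \<times> P\<close>. Instead of this group, its faithful permutation representation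
  on \<open>L \<times> Q \<times> P\<close> is used.
\<close>

text \<open>Elements of \<open>Bij S\<close> are extensional, so they lie in the finite set of
  extensional maps from \<open>S\<close> to itself.\<close>

lemma finite_Bij: "finite S \<Longrightarrow> finite (Bij S)"
  by (rule finite_subset[OF _ finite_PiE[of S "\<lambda>_. S"]])
     (auto simp: Bij_def bij_betw_def PiE_def)

lemma partial_homD:
  assumes "\<phi> \<in> partial_hom G A K"
  shows "g \<in> A \<Longrightarrow> \<phi> g \<in> carrier K"
    and "\<lbrakk>g \<in> A; h \<in> A; g \<otimes>\<^bsub>G\<^esub> h \<in> A\<rbrakk> \<Longrightarrow> \<phi> (g \<otimes>\<^bsub>G\<^esub> h) = \<phi> g \<otimes>\<^bsub>K\<^esub> \<phi> h"
  using assms by (auto simp: partial_hom_def)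

lemma LEF_obtain:
  assumes "LEF G" "finite A" "A \<subseteq> carrier G"
  obtains Q :: "nat monoid" and \<phi> where "group Q" "finite (carrier Q)"
    "\<phi> \<in> partial_hom G A Q" "inj_on \<phi> A"
  using assms unfolding LEF_def by blast

lemma class_LEF_action_obtain:
  assumes "class_LEF_action C G D \<beta>" "finite F" "F \<subseteq> carrier G" "finite E" "E \<subseteq> carrier D"
  obtains Q :: "nat monoid" and K \<gamma> \<rho> \<pi> where "group Q" "finite (carrier Q)" "K \<in> C"
    "action_by_automorphisms Q K \<gamma>" "\<rho> \<in> partial_hom G F Q" "\<pi> \<in> partial_hom D E K"
    "inj_on \<pi> E" "\<forall>g\<in>F. \<forall>h\<in>E. \<beta> g h \<in> E \<longrightarrow> \<pi> (\<beta> g h) = \<gamma> (\<rho> g) (\<pi> h)"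
proof -
  note assms(1)[unfolded class_LEF_action_def, THEN conjunct2, rule_format, of F E]
  with assms(2-5) show ?thesis
    by (elim exE conjE meta_impE) (use that in auto)
qed

context
  fixes G :: "('g, 'm) monoid_scheme" and D :: "('d, 'n) monoid_scheme" and \<beta>
  assumes action: "action_by_automorphisms G D \<beta>"
begin

lemma action_groups: "group G" "group D"
  using action by (simp_all add: action_by_automorphisms_def)

lemma action_auto: "g \<in> carrier G \<Longrightarrow> \<beta> g \<in> auto D"
  using action by (auto simp: action_by_automorphisms_def hom_def AutoGroup_def)

lemma action_closed: "\<lbrakk>g \<in> carrier G; d \<in> carrier D\<rbrakk> \<Longrightarrow> \<beta> g d \<in> carrier D"
  using action_auto[of g] by (auto simp: auto_def hom_def)

lemma action_inj: "g \<in> carrier G \<Longrightarrow> inj_on (\<beta> g) (carrier D)"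
  using action_auto[of g] by (auto simp: auto_def Bij_def bij_betw_def)

lemma action_hom:
  "\<lbrakk>g \<in> carrier G; d \<in> carrier D; e \<in> carrier D\<rbrakk> \<Longrightarrow> \<beta> g (d \<otimes>\<^bsub>D\<^esub> e) = \<beta> g d \<otimes>\<^bsub>D\<^esub> \<beta> g e"
  using action_auto[of g] by (auto simp: auto_def hom_def)

lemma action_one_right: "g \<in> carrier G \<Longrightarrow> \<beta> g \<one>\<^bsub>D\<^esub> = \<one>\<^bsub>D\<^esub>"
  using action_auto action_groups by (auto simp: auto_def intro!: hom_one)

lemma action_mult:
  assumes "g \<in> carrier G" "h \<in> carrier G" "d \<in> carrier D"
  shows "\<beta> (g \<otimes>\<^bsub>G\<^esub> h) d = \<beta> g (\<beta> h d)"
proof -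
  have "\<beta> (g \<otimes>\<^bsub>G\<^esub> h) = compose (carrier D) (\<beta> g) (\<beta> h)"
    using action assms action_auto[of g] action_auto[of h]
    by (auto simp: action_by_automorphisms_def hom_def AutoGroup_def BijGroup_def auto_def)
  thus ?thesis using assms by (simp add: compose_eq)
qed

text \<open>By \<open>action_mult\<close>, \<open>\<beta> \<one>\<close> is idempotent on
  \<open>carrier D\<close>, and an injective idempotent map is the identity.\<close>

lemma action_one_left:
  assumes "d \<in> carrier D"
  shows "\<beta> \<one>\<^bsub>G\<^esub> d = d"
proof -
  interpret G: group G by (rule action_groups)
  have "\<beta> \<one>\<^bsub>G\<^esub> (\<beta> \<one>\<^bsub>G\<^esub> d) = \<beta> \<one>\<^bsub>G\<^esub> d"
    using action_mult[of "\<one>\<^bsub>G\<^esub>" "\<one>\<^bsub>G\<^esub>" d] assms by simp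
  thus ?thesis
    using action_inj[of "\<one>\<^bsub>G\<^esub>"] action_closed assms by (auto dest: inj_onD)
qed

lemma group_semidirect_product: "group (semidirect_product D \<beta> G)"
proof -
  interpret G: group G by (rule action_groups)
  interpret D: group D by (rule action_groups)
  show ?thesis
  proof (rule groupI)
    fix x assume "x \<in> carrier (semidirect_product D \<beta> G)"
    then obtain d g where x: "x = (d, g)" "d \<in> carrier D" "g \<in> carrier G"
      by (auto simp: semidirect_product_def)
    \<comment> \<open>A left inverse: reading \<open>action_hom\<close> from right to left merges
      the first coordinate of \<open>?y\<close> times \<open>x\<close> into
      \<open>\<beta> (inv g) (inv d \<otimes> d)\<close>, which is \<open>\<one>\<close>.\<close>
    let ?y = "(\<beta> (inv\<^bsub>G\<^esub> g) (inv\<^bsub>D\<^esub> d), inv\<^bsub>G\<^esub> g)"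
    have "?y \<otimes>\<^bsub>semidirect_product D \<beta> G\<^esub> x = \<one>\<^bsub>semidirect_product D \<beta> G\<^esub>"
      using x by (simp add: semidirect_product_def action_one_right flip: action_hom)
    moreover have "?y \<in> carrier (semidirect_product D \<beta> G)"
      using x by (simp add: semidirect_product_def action_closed)
    ultimately show "\<exists>y\<in>carrier (semidirect_product D \<beta> G).
        y \<otimes>\<^bsub>semidirect_product D \<beta> G\<^esub> x = \<one>\<^bsub>semidirect_product D \<beta> G\<^esub>" ..
  qed (auto simp: semidirect_product_def action_closed action_hom action_mult
        action_one_left G.m_assoc D.m_assoc)
qed

end

theorem theorem1p5:
  fixes \<Gamma> :: "('g, 'm) monoid_scheme" and \<Delta> :: "('d, 'n) monoid_scheme"
    and \<beta> :: "'g \<Rightarrow> 'd \<Rightarrow> 'd" and C :: "'k monoid set"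
  assumes "C = {K. LEF K}"
    and "LEF \<Gamma>"
    and "group \<Delta>"
    and "action_by_automorphisms \<Gamma> \<Delta> \<beta>"
    and "class_LEF_action C \<Gamma> \<Delta> \<beta>"
  shows "LEF (semidirect_product \<Delta> \<beta> \<Gamma>)"
  unfolding LEF_def
proof (intro conjI allI impI)
  show "group (semidirect_product \<Delta> \<beta> \<Gamma>)"
    using assms(4) by (rule group_semidirect_product)
next
  fix A assume "finite A \<and> A \<subseteq> carrier (semidirect_product \<Delta> \<beta> \<Gamma>)"
  hence A: "finite A" "A \<subseteq> carrier \<Delta> \<times> carrier \<Gamma>"
    by (auto simp: semidirect_product_def)
  define F where "F = snd ` A"
  \<comment> \<open>The product of \<open>(d, g)\<close> and \<open>(e, h)\<close> has first
    coordinate \<open>d \<otimes> \<beta> g e\<close>. For \<open>\<pi>\<close> to split it, the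
    twisted factor \<open>\<beta> g e\<close> must lie in \<open>E\<close> too.\<close>
  define E where "E = fst ` A \<union> (\<Union>g\<in>F. \<beta> g ` fst ` A)"
  have F: "finite F" "F \<subseteq> carrier \<Gamma>"
    using A by (auto simp: F_def)
  have E: "finite E" "E \<subseteq> carrier \<Delta>"
    using A F by (auto simp: E_def intro!: action_closed[OF assms(4)])
  obtain P :: "nat monoid" and \<sigma> where P: "group P" "finite (carrier P)"
    and \<sigma>: "\<sigma> \<in> partial_hom \<Gamma> F P" "inj_on \<sigma> F"
    using LEF_obtain[OF assms(2) F] .
  obtain Q :: "nat monoid" and K \<gamma> \<rho> \<pi>
    where Q: "group Q" "finite (carrier Q)" and "K \<in> C"
      and \<gamma>: "action_by_automorphisms Q K \<gamma>" and \<rho>: "\<rho> \<in> partial_hom \<Gamma> F Q"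
      and \<pi>: "\<pi> \<in> partial_hom \<Delta> E K" "inj_on \<pi> E"
      and equivariant: "\<forall>g\<in>F. \<forall>h\<in>E. \<beta> g h \<in> E \<longrightarrow> \<pi> (\<beta> g h) = \<gamma> (\<rho> g) (\<pi> h)"
    using class_LEF_action_obtain[OF assms(5) F E] .
  \<comment> \<open>The union of the \<open>Q\<close>-orbits that meet the image of
    \<open>E\<close>; it is finite because \<open>Q\<close> is.\<close>
  define B where "B = (\<Union>x\<in>carrier Q. \<gamma> x ` \<pi> ` E)"
  have B: "finite B" "B \<subseteq> carrier K"
    using E Q by (auto simp: B_def intro!: action_closed[OF \<gamma>] partial_homD(1)[OF \<pi>(1)])
  obtain L :: "nat monoid" and \<psi> where L: "group L" "finite (carrier L)"
    and \<psi>: "\<psi> \<in> partial_hom K B L" "inj_on \<psi> B"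
    using LEF_obtain[OF _ B] \<open>K \<in> C\<close> assms(1) by blast
  interpret P: group P by fact
  interpret Q: group Q by fact
  interpret L: group L by fact
  have B_mem: "\<gamma> x (\<pi> e) \<in> B" if "x \<in> carrier Q" "e \<in> E" for x e
    using that by (auto simp: B_def)
  define S where "S = carrier L \<times> carrier Q \<times> carrier P"
  \<comment> \<open>A pair \<open>(f, q)\<close> of the wreath product acts on \<open>(l, x)\<close>
    by moving \<open>x\<close> to \<open>q \<otimes> x\<close> and multiplying \<open>l\<close> on
    the left by the value of \<open>f\<close> at this new point. On the last coordinate
    \<open>P\<close> acts by left translation.\<close>
  define \<Phi> where "\<Phi> = (\<lambda>(d, g). \<lambda>(l, x, p)\<in>S.
    (\<psi> (\<gamma> (inv\<^bsub>Q\<^esub> (\<rho> g \<otimes>\<^bsub>Q\<^esub> x)) (\<pi> d)) \<otimes>\<^bsub>L\<^esub> l, \<rho> g \<otimes>\<^bsub>Q\<^esub> x, \<sigma> g \<otimes>\<^bsub>P\<^esub> p))"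
  have "finite S" using L P Q by (simp add: S_def)
  have mem: "d \<in> E" "g \<in> F" "\<pi> d \<in> carrier K" "\<rho> g \<in> carrier Q" "\<sigma> g \<in> carrier P"
    if "(d, g) \<in> A" for d g
  proof -
    show "d \<in> E" "g \<in> F" using that by (force simp: E_def F_def)+
    thus "\<pi> d \<in> carrier K" "\<rho> g \<in> carrier Q" "\<sigma> g \<in> carrier P"
      using partial_homD(1)[OF \<pi>(1)] partial_homD(1)[OF \<rho>] partial_homD(1)[OF \<sigma>(1)] by auto
  qed
  have \<psi>_mem: "\<psi> (\<gamma> x (\<pi> d)) \<in> carrier L" if "x \<in> carrier Q" "d \<in> E" for x d
    using partial_homD(1)[OF \<psi>(1)] B_mem that by blast
  have \<Phi>_Bij: "\<Phi> a \<in> Bij S" if "a \<in> A" for a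
  proof -
    obtain d g where a: "a = (d, g)" by force
    note m = mem[OF that[unfolded a]]
    have "\<Phi> a ` S \<subseteq> S"
      using m \<psi>_mem by (auto simp: \<Phi>_def S_def a)
    \<comment> \<open>Cancellation in \<open>Q\<close> and \<open>P\<close> recovers
      \<open>x\<close> and \<open>p\<close>. The multiplier of \<open>l\<close> depends only on
      \<open>x\<close>, so cancellation in \<open>L\<close> recovers \<open>l\<close>. Surjectivity
      follows from finiteness of \<open>S\<close>.\<close>
    moreover have "inj_on (\<Phi> a) S"
      using m \<psi>_mem by (auto simp: \<Phi>_def S_def a inj_on_def)
    ultimately show ?thesis
      using endo_inj_surj[OF \<open>finite S\<close>] by (auto simp: Bij_def bij_betw_def \<Phi>_def a)
  qed
  have "\<Phi> \<in> partial_hom (semidirect_product \<Delta> \<beta> \<Gamma>) A (BijGroup S)"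
    unfolding partial_hom_def
  proof (intro CollectI conjI ballI impI Pi_I)
    show "\<Phi> a \<in> carrier (BijGroup S)" if "a \<in> A" for a
      using \<Phi>_Bij[OF that] by (simp add: BijGroup_def)
  next
    fix a b assume ab: "a \<in> A" "b \<in> A" "a \<otimes>\<^bsub>semidirect_product \<Delta> \<beta> \<Gamma>\<^esub> b \<in> A"
    obtain d g e h where eq: "a = (d, g)" "b = (e, h)" by force
    define c where "c = d \<otimes>\<^bsub>\<Delta>\<^esub> \<beta> g e"
    have "(c, g \<otimes>\<^bsub>\<Gamma>\<^esub> h) \<in> A"
      using ab by (simp add: semidirect_product_def eq c_def)
    note m = mem[OF ab(1)[unfolded eq]] mem[OF ab(2)[unfolded eq]] mem[OF this]
    have "\<beta> g e \<in> E"
      using ab m(2) by (force simp: E_def eq)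
    hence \<pi>c: "\<pi> c = \<pi> d \<otimes>\<^bsub>K\<^esub> \<gamma> (\<rho> g) (\<pi> e)"
      using m equivariant partial_homD(2)[OF \<pi>(1), of d "\<beta> g e"] by (simp add: c_def)
    have \<rho>gh: "\<rho> (g \<otimes>\<^bsub>\<Gamma>\<^esub> h) = \<rho> g \<otimes>\<^bsub>Q\<^esub> \<rho> h" and \<sigma>gh: "\<sigma> (g \<otimes>\<^bsub>\<Gamma>\<^esub> h) = \<sigma> g \<otimes>\<^bsub>P\<^esub> \<sigma> h"
      using m partial_homD(2)[OF \<rho>] partial_homD(2)[OF \<sigma>(1)] by auto
    \<comment> \<open>Apply the automorphism \<open>\<gamma> y\<close> to \<open>\<pi>c\<close>.
      Both factors and their product lie in \<open>B\<close>, so the partial homomorphism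
      \<open>\<psi>\<close> respects the product.\<close>
    have \<psi>c: "\<psi> (\<gamma> y (\<pi> c)) = \<psi> (\<gamma> y (\<pi> d)) \<otimes>\<^bsub>L\<^esub> \<psi> (\<gamma> (y \<otimes>\<^bsub>Q\<^esub> \<rho> g) (\<pi> e))"
      if y: "y \<in> carrier Q" for y
    proof -
      have "\<gamma> y (\<pi> c) = \<gamma> y (\<pi> d) \<otimes>\<^bsub>K\<^esub> \<gamma> (y \<otimes>\<^bsub>Q\<^esub> \<rho> g) (\<pi> e)"
        using m y by (simp add: \<pi>c action_hom[OF \<gamma>] action_mult[OF \<gamma>] action_closed[OF \<gamma>])
      thus ?thesis
        using partial_homD(2)[OF \<psi>(1), of "\<gamma> y (\<pi> d)" "\<gamma> (y \<otimes>\<^bsub>Q\<^esub> \<rho> g) (\<pi> e)"] m y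
          B_mem[of y d] B_mem[of "y \<otimes>\<^bsub>Q\<^esub> \<rho> g" e] B_mem[of y c] by simp
    qed
    have "\<Phi> (c, g \<otimes>\<^bsub>\<Gamma>\<^esub> h) = compose S (\<Phi> a) (\<Phi> b)"
    proof
      fix s
      show "\<Phi> (c, g \<otimes>\<^bsub>\<Gamma>\<^esub> h) s = compose S (\<Phi> a) (\<Phi> b) s"
      proof (cases "s \<in> S")
        case True
        then obtain l x p
          where s: "s = (l, x, p)" "l \<in> carrier L" "x \<in> carrier Q" "p \<in> carrier P"
          by (auto simp: S_def)
        \<comment> \<open>With \<open>y\<close> the inverse on the left, the second factor in
          \<open>\<psi>c\<close> becomes exactly the multiplier that \<open>\<Phi> b\<close> uses at
          \<open>s\<close>.\<close>
        have "inv\<^bsub>Q\<^esub> (\<rho> g \<otimes>\<^bsub>Q\<^esub> (\<rho> h \<otimes>\<^bsub>Q\<^esub> x)) \<otimes>\<^bsub>Q\<^esub> \<rho> g = inv\<^bsub>Q\<^esub> (\<rho> h \<otimes>\<^bsub>Q\<^esub> x)"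
          using m s by (simp add: Q.inv_mult_group Q.m_assoc)
        thus ?thesis
          using m s by (simp add: \<Phi>_def S_def eq compose_def \<rho>gh \<sigma>gh \<psi>c \<psi>_mem
            Q.m_assoc P.m_assoc L.m_assoc)
      qed (simp add: \<Phi>_def compose_def)
    qed
    thus "\<Phi> (a \<otimes>\<^bsub>semidirect_product \<Delta> \<beta> \<Gamma>\<^esub> b) = \<Phi> a \<otimes>\<^bsub>BijGroup S\<^esub> \<Phi> b"
      using \<Phi>_Bij ab(1,2) by (simp add: BijGroup_def semidirect_product_def eq c_def)
  qed
  moreover have "inj_on \<Phi> A"
  proof (rule inj_onI)
    fix a b assume ab: "a \<in> A" "b \<in> A" "\<Phi> a = \<Phi> b"
    obtain d g e h where eq: "a = (d, g)" "b = (e, h)" by force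
    note m = mem[OF ab(1)[unfolded eq]] mem[OF ab(2)[unfolded eq]]
    \<comment> \<open>One point separates everything. Its \<open>P\<close>-coordinate yields
      \<open>g = h\<close>, which \<open>\<rho>\<close> could not, as it may fail to be injective.
      Its \<open>L\<close>-coordinate then yields \<open>d = e\<close> by undoing
      \<open>\<psi>\<close>, the automorphism and \<open>\<pi>\<close> in turn.\<close>
    have \<Phi>_one: "\<Phi> a (\<one>\<^bsub>L\<^esub>, \<one>\<^bsub>Q\<^esub>, \<one>\<^bsub>P\<^esub>) = \<Phi> b (\<one>\<^bsub>L\<^esub>, \<one>\<^bsub>Q\<^esub>, \<one>\<^bsub>P\<^esub>)" using ab(3) by simp
    hence "\<sigma> g = \<sigma> h"
      using m by (simp add: \<Phi>_def S_def eq)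
    hence "g = h" using \<sigma>(2) m by (auto dest: inj_onD)
    hence "\<psi> (\<gamma> (inv\<^bsub>Q\<^esub> (\<rho> g)) (\<pi> d)) = \<psi> (\<gamma> (inv\<^bsub>Q\<^esub> (\<rho> g)) (\<pi> e))"
      using \<Phi>_one m by (simp add: \<Phi>_def S_def eq \<psi>_mem)
    hence "\<gamma> (inv\<^bsub>Q\<^esub> (\<rho> g)) (\<pi> d) = \<gamma> (inv\<^bsub>Q\<^esub> (\<rho> g)) (\<pi> e)"
      using m by (auto intro: inj_onD[OF \<psi>(2) _ B_mem B_mem])
    hence "\<pi> d = \<pi> e"
      using m by (auto intro: inj_onD[OF action_inj[OF \<gamma>, of "inv\<^bsub>Q\<^esub> (\<rho> g)"]])
    hence "d = e" using \<pi>(2) m by (auto dest: inj_onD)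
    with \<open>g = h\<close> show "a = b" by (simp add: eq)
  qed
  moreover have "finite (carrier (BijGroup S))"
    using finite_Bij[OF \<open>finite S\<close>] by (simp add: BijGroup_def)
  ultimately show "\<exists>(Q :: nat monoid) \<phi>. group Q \<and> finite (carrier Q) \<and>
      \<phi> \<in> partial_hom (semidirect_product \<Delta> \<beta> \<Gamma>) A Q \<and> inj_on \<phi> A"
    \<comment> \<open>The permutation group of \<open>S\<close> is transported to a group on natural
      numbers.\<close>
    by (intro LEF_witness_any_type[OF group_BijGroup])
qed

end
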